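(* Let $B_{0,1}=B[\mathbf{c}_{0,1};r]$ be a closed ball with $r>0$ and $\mathbf{s}\in B_{0,1}$, and let $\{\mathcal{C}_k\}_{k\ge 0}$ be the sequence of finite families of closed balls defined in the context, starting from $\mathcal{C}_0=\{B_{0,1}\}$. For each $k\ge 1$ let $\mathbf{z}_k$ be the center of an arbitrarily chosen ball of $\mathcal{C}_k$. Then $\mathbf{z}_k\to\mathbf{s}$ as $k\to\infty$, that is, $\rho(\mathbf{z}_k;\mathbf{s})\to 0$.
   Context: Setting: $(X;\rho)$ is a metric space which is proper, i.e. every closed ball is compact. $B[\mathbf{c};r]=\{\mathbf{x}\in X\mid\rho(\mathbf{x};\mathbf{c})\le r\}$ is the closed ball; balls are regarded as given together with their center and radius. $\mathbf{r}_1,\dots,\mathbf{r}_n\in X$ ($n\ge 1$) are pairwise distinct points (sensors), $\mathbf{s}\in X$ (the source), $t_0\in\mathbb{R}$, and $t_i=t_0+\rho(\mathbf{r}_i;\mathbf{s})$ for $i=1,\dots,n$. A solution of the sound ranging problem $(\{\mathbf{r}_i\};\{t_i\})$ is a pair $(\mathbf{s}';t')\in X\times\mathbb{R}$ with $t_i=t'+\rho(\mathbf{r}_i;\mathbf{s}')$ for all $i=1,\dots,n$; since $t'$ is determined by $\mathbf{s}'$, the point $\mathbf{s}'$ itself is also called a solution. It is assumed that the solution $\mathbf{s}$ is unique. Definitions: for $\mathbf{x}\in X$, $\tau_i(\mathbf{x})=t_i-\rho(\mathbf{x};\mathbf{r}_i)$, and the defect is $D(\mathbf{x})=\frac1n\sum_{i=1}^n\bigl|\tau_i(\mathbf{x})-\frac1n\sum_{j=1}^n\tau_j(\mathbf{x})\bigr|$.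 A closed ball $B[\mathbf{c};r]$ belongs to the class $\mathcal{N}$ (negative) if $2r<D(\mathbf{c})$, and to the class $\mathcal{S}$ (suspicious) otherwise, i.e. if $D(\mathbf{c})\le 2r$. Refining covers: fix a real constant $K_1\ge 1$ and, for every closed ball $B=B[\mathbf{z};r]$ with $r>0$, a finite family $\mathcal{B}(B)$ of closed balls of radius $\frac r2$ whose union contains $B$ and whose centers $\mathbf{c}$ all satisfy $\rho(\mathbf{c};\mathbf{z})\le K_1 r$. Process: $r_k=r/2^k$ and $\mathcal{C}_0=\{B_{0,1}\}$. For $k\ge 0$, $\mathcal{C}_{k+1}$ is the family of all balls $B'=B[\mathbf{c};r_{k+1}]$ such that $B'\in\mathcal{B}(B)$ for some $B\in\mathcal{C}_k$ and $B'\in\mathcal{S}$. (Each $\mathcal{C}_k$ is nonempty.) *)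

theory Defs
  imports "HOL-Analysis.Analysis"
begin

definition proper_space :: "'a::metric_space itself \<Rightarrow> bool" where
  "proper_space _ \<longleftrightarrow> (\<forall>(c::'a) (r::real). compact (cball c r))"

text \<open>Sensors \<open>R\<close> and arrival times \<open>t\<close> are indexed by \<open>{1..n}\<close>; their values at
  other indices are never used.\<close>

definition ranging_solution ::
  "nat \<Rightarrow> (nat \<Rightarrow> 'a::metric_space) \<Rightarrow> (nat \<Rightarrow> real) \<Rightarrow> 'a \<Rightarrow> real \<Rightarrow> bool" where
  "ranging_solution n R t s' t' \<longleftrightarrow> (\<forall>i\<in>{1..n}. t i = t' + dist (R i) s')"

definition emission_time ::
  "(nat \<Rightarrow> 'a::metric_space) \<Rightarrow> (nat \<Rightarrow> real) \<Rightarrow> nat \<Rightarrow> 'a \<Rightarrow> real" where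
  "emission_time R t i x = t i - dist x (R i)"

definition defect ::
  "nat \<Rightarrow> (nat \<Rightarrow> 'a::metric_space) \<Rightarrow> (nat \<Rightarrow> real) \<Rightarrow> 'a \<Rightarrow> real" where
  "defect n R t x =
     (1 / real n) * (\<Sum>i=1..n. \<bar>emission_time R t i x
                              - (1 / real n) * (\<Sum>j=1..n. emission_time R t j x)\<bar>)"

text \<open>A ball is given together with its center and radius (which the underlying set need
  not determine), so it is encoded as the pair of them; its set of points is
  \<open>cball (fst B) (snd B)\<close>.\<close>

type_synonym 'a ball = "'a \<times> real"

definition negative_ball ::
  "nat \<Rightarrow> (nat \<Rightarrow> 'a::metric_space) \<Rightarrow> (nat \<Rightarrow> real) \<Rightarrow> 'a ball \<Rightarrow> bool" where
  "negative_ball n R t B \<longleftrightarrow> 2 * snd B < defect n R t (fst B)"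

definition suspicious_ball ::
  "nat \<Rightarrow> (nat \<Rightarrow> 'a::metric_space) \<Rightarrow> (nat \<Rightarrow> real) \<Rightarrow> 'a ball \<Rightarrow> bool" where
  "suspicious_ball n R t B \<longleftrightarrow> \<not> negative_ball n R t B"

definition refining_covers :: "real \<Rightarrow> ('a::metric_space ball \<Rightarrow> 'a ball set) \<Rightarrow> bool" where
  "refining_covers K \<B> \<longleftrightarrow>
     (\<forall>z r. r > 0 \<longrightarrow>
        finite (\<B> (z, r)) \<and>
        (\<forall>B\<in>\<B> (z, r). snd B = r / 2 \<and> dist (fst B) z \<le> K * r) \<and>
        cball z r \<subseteq> (\<Union>B\<in>\<B> (z, r). cball (fst B) (snd B)))"

primrec ball_process ::
  "nat \<Rightarrow> (nat \<Rightarrow> 'a::metric_space) \<Rightarrow> (nat \<Rightarrow> real) \<Rightarrow> ('a ball \<Rightarrow> 'a ball set)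
     \<Rightarrow> 'a ball \<Rightarrow> nat \<Rightarrow> 'a ball set" where
  "ball_process n R t \<B> B0 0 = {B0}"
| "ball_process n R t \<B> B0 (Suc k) =
     {B'. snd B' = snd B0 / 2 ^ Suc k \<and>
          (\<exists>B\<in>ball_process n R t \<B> B0 k. B' \<in> \<B> B) \<and>
          suspicious_ball n R t B'}"

end

theory Submission
  imports Defs
begin

text \<open>The defect is continuous and vanishes only at solutions, hence only at \<open>s\<close>. The centers
  stay in a fixed ball, because the displacements from one generation to the next sum to at most
  \<open>2 * K1 * r\<close>, and their defects are at most \<open>2 * r / 2 ^ k\<close>. On the compact part of that ball
  at distance at least \<open>e\<close> from \<open>s\<close> the defect has a positive minimum, so the centers
  eventually leave it.\<close>

text \<open>Compactness turns pointwise positivity away from \<open>s\<close> into a uniform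
  positive lower bound outside each ball around \<open>s\<close>, so small values of
  \<open>f\<close> force closeness to \<open>s\<close>.\<close>

lemma tendsto_unique_zero_compact:
  fixes f :: "'a::metric_space \<Rightarrow> real"
  assumes "compact K" and cont: "continuous_on K f"
    and pos: "\<And>x. x \<in> K \<Longrightarrow> x \<noteq> s \<Longrightarrow> f x > 0"
    and z: "\<forall>\<^sub>F k in F. z k \<in> K" and lim: "((\<lambda>k. f (z k)) \<longlongrightarrow> 0) F"
  shows "(z \<longlongrightarrow> s) F"
proof (rule tendstoI)
  fix e :: real
  assume "e > 0"
  define L where "L = K - ball s e"
  have "compact L"
    unfolding L_def using \<open>compact K\<close> by (intro compact_diff) auto
  have "\<exists>m>0. \<forall>x\<in>L. m \<le> f x"
  \<comment> \<open>A minimum is attained only on a nonempty set; for empty \<open>L\<close> the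
    bound 1 serves vacuously.\<close>
  proof (cases "L = {}")
    case False
    have "continuous_on L f"
      using cont by (rule continuous_on_subset) (auto simp: L_def)
    then obtain x where x: "x \<in> L" "\<forall>y\<in>L. f x \<le> f y"
      using continuous_attains_inf[OF \<open>compact L\<close> False] by blast
    then have "f x > 0"
      using \<open>e > 0\<close> by (intro pos) (auto simp: L_def)
    with x show ?thesis by blast
  qed (auto intro: exI[of _ 1])
  then obtain m where m: "m > 0" "\<forall>x\<in>L. m \<le> f x" by blast
  have "\<forall>\<^sub>F k in F. f (z k) < m"
    using lim m(1) by (rule order_tendstoD(2))
  with z show "\<forall>\<^sub>F k in F. dist (z k) s < e"
  proof eventually_elim
    case (elim k)
    then have "z k \<notin> L" using m(2) by force
    with elim show ?case by (auto simp: L_def dist_commute)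
  qed
qed

lemma continuous_on_defect: "continuous_on A (defect n R t)"
  unfolding defect_def emission_time_def by (intro continuous_intros)

lemma defect_nonneg: "defect n R t x \<ge> 0"
  unfolding defect_def by (intro mult_nonneg_nonneg sum_nonneg) auto

text \<open>The defect is the mean absolute deviation of the emission times. If it vanishes, they
  all equal their mean, and this mean serves as \<open>t'\<close>.\<close>

lemma defect_eq_0_imp_solution:
  assumes "defect n R t x = 0"
  shows "\<exists>t'. ranging_solution n R t x t'"
\<comment> \<open>For \<open>n = 0\<close> the factor \<open>1 / real n\<close> is 0 and cannot be
  cancelled, but then every pair is vacuously a solution.\<close>
proof (cases "n = 0")
  case False
  define m where "m = (1 / real n) * (\<Sum>j=1..n. emission_time R t j x)"
  have "(\<Sum>i=1..n. \<bar>emission_time R t i x - m\<bar>) = 0"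
    using assms False by (simp add: defect_def m_def)
  then have "\<forall>i\<in>{1..n}. emission_time R t i x = m"
    by (subst (asm) sum_nonneg_eq_0_iff) auto
  then have "ranging_solution n R t x m"
    by (fastforce simp: ranging_solution_def emission_time_def dist_commute)
  then show ?thesis ..
qed (simp add: ranging_solution_def)

lemma ball_process_radius:
  "B \<in> ball_process n R t \<B> B0 k \<Longrightarrow> snd B = snd B0 / 2 ^ k"
  by (cases k) auto

text \<open>The bound is the exact partial sum of the geometric series with terms
  \<open>K * snd B0 / 2 ^ j\<close> for \<open>j < k\<close>; keeping the factor
  \<open>1 - 1 / 2 ^ k\<close> leaves room for the next term in the induction.\<close>

lemma ball_process_dist_center:
  assumes "refining_covers K \<B>" and "snd B0 > 0" and "B \<in> ball_process n R t \<B> B0 k"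
  shows "dist (fst B) (fst B0) \<le> 2 * K * snd B0 * (1 - 1 / 2 ^ k)"
  using assms(3)
proof (induction k arbitrary: B)
  case (Suc k)
  then obtain A where A: "A \<in> ball_process n R t \<B> B0 k" "B \<in> \<B> A"
    by auto
  have "snd A = snd B0 / 2 ^ k"
    using A(1) by (rule ball_process_radius)
  \<comment> \<open>The radius of the parent \<open>A\<close> controls the displacement, hence the
    exponent \<open>k\<close> and not \<open>Suc k\<close>.\<close>
  then have "dist (fst B) (fst A) \<le> K * (snd B0 / 2 ^ k)"
    using assms(1,2) A(2) unfolding refining_covers_def
    by (metis prod.collapse zero_less_divide_iff zero_less_numeral zero_less_power)
  with Suc.IH[OF A(1)]
  have "dist (fst B) (fst B0) \<le> 2 * K * snd B0 * (1 - 1 / 2 ^ k) + K * (snd B0 / 2 ^ k)"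
    using dist_triangle[of "fst B" "fst B0" "fst A"] by linarith
  also have "\<dots> = 2 * K * snd B0 * (1 - 1 / 2 ^ Suc k)"
    by (simp add: field_simps)
  finally show ?case .
qed simp

text \<open>The starting ball enters untested; from generation 1 on, every ball has passed the test
  for suspicion, which is this bound at its radius.\<close>

lemma ball_process_defect:
  assumes "k \<ge> 1" and "B \<in> ball_process n R t \<B> B0 k"
  shows "defect n R t (fst B) \<le> 2 * snd B0 / 2 ^ k"
proof -
  have "suspicious_ball n R t B"
    using assms by (cases k) auto
  then show ?thesis
    using ball_process_radius[OF assms(2)]
    by (simp add: suspicious_ball_def negative_ball_def)
qed

theorem proposition8:
  fixes R :: "nat \<Rightarrow> 'a::metric_space" and n :: nat
    and s c0 :: 'a and t0 r K1 :: real and t :: "nat \<Rightarrow> real"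
    and \<B> :: "'a ball \<Rightarrow> 'a ball set" and z :: "nat \<Rightarrow> 'a"
  assumes proper: "proper_space TYPE('a)"
    and sensors: "n \<ge> 1" "inj_on R {1..n}"
    and times: "\<And>i. i \<in> {1..n} \<Longrightarrow> t i = t0 + dist (R i) s"
    and unique: "\<And>s' t'. ranging_solution n R t s' t' \<Longrightarrow> s' = s"
    and covers: "K1 \<ge> 1" "refining_covers K1 \<B>"
    and start: "r > 0" "s \<in> cball c0 r"
    and centers: "\<And>k. k \<ge> 1 \<Longrightarrow> z k \<in> fst ` ball_process n R t \<B> (c0, r) k"
  shows "z \<longlonglongrightarrow> s"
proof (rule tendsto_unique_zero_compact)
  show "compact (cball c0 (2 * K1 * r))"
    using proper by (simp add: proper_space_def)
  show "continuous_on (cball c0 (2 * K1 * r)) (defect n R t)"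
    by (rule continuous_on_defect)
  show "defect n R t x > 0" if "x \<noteq> s" for x
    using that unique defect_eq_0_imp_solution defect_nonneg
    by (metis order_less_le)
  have "z k \<in> cball c0 (2 * K1 * r) \<and> defect n R t (z k) \<le> 2 * r / 2 ^ k" if k: "k \<ge> 1" for k
  proof -
    obtain B where B: "B \<in> ball_process n R t \<B> (c0, r) k" "z k = fst B"
      using centers[OF k] by blast
    have "dist (z k) c0 \<le> 2 * K1 * r * (1 - 1 / 2 ^ k)"
      using ball_process_dist_center[OF covers(2) _ B(1)] start(1) B(2) by simp
    also have "\<dots> \<le> 2 * K1 * r"
      using covers(1) start(1) by (intro mult_left_le) auto
    finally show ?thesis
      using ball_process_defect[OF k B(1)] B(2) by (simp add: dist_commute)
  qed
  \<comment> \<open>\<open>centers\<close> does not constrain \<open>z 0\<close>, so the two facts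
    are passed on as eventual ones.\<close>
  then have ev: "\<forall>\<^sub>F k in sequentially.
      z k \<in> cball c0 (2 * K1 * r) \<and> defect n R t (z k) \<le> 2 * r / 2 ^ k"
    by (auto simp: eventually_sequentially)
  then show "\<forall>\<^sub>F k in sequentially. z k \<in> cball c0 (2 * K1 * r)"
    by (rule eventually_mono) blast
  have lim: "(\<lambda>k. 2 * r / 2 ^ k) \<longlonglongrightarrow> 0"
    by (rule LIMSEQ_divide_realpow_zero) simp
  show "(\<lambda>k. defect n R t (z k)) \<longlonglongrightarrow> 0"
    by (rule tendsto_sandwich[OF _ _ tendsto_const lim])
      (auto simp: defect_nonneg intro: eventually_mono[OF ev])
qed

end
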